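(* In the secretary problem with samples (setting in the context), for every $n\ge 1$ and every $k\ge 0$ the optimal policy is a threshold policy.
   Context: Secretary problem with samples: an adversary chooses $n+k$ distinct real numbers. A uniformly random subset of $k$ of them is revealed to the algorithm at the outset as samples; the remaining $n$ numbers (the secretaries) are then presented one by one in uniformly random order. At time $i$ the algorithm knows the relative order of all samples and of all secretaries seen so far, and must irrevocably decide whether to select the current secretary; it wins if it selects the largest of the $n$ secretaries. The signal of the $i$-th secretary is $s_i\in\{0,1,\dots,k\}$, the number of samples smaller than it. The best-so-far event $T_i$ is the event that the $i$-th secretary is larger than all earlier secretaries. A threshold policy is given by a function $t:\{0,\dots,k\}\to\{1,\dots,n\}$ and stops at $\tau=\min\{i: T_i\text{ occurs and } i\ge t(s_i)\}$. An optimal policy maximizes the winning probability among all (possibly randomized) policies. *)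

theory Defs
  imports "HOL-Probability.Probability" "HOL-Combinatorics.Multiset_Permutations"
begin

text \<open>
  An outcome \<open>(S, xs)\<close> consists of the set \<open>S\<close> of samples and the list \<open>xs\<close> of the secretaries in
  their order of arrival, where \<open>X\<close> is the set of numbers chosen by the adversary.
\<close>

definition arrival :: "nat \<Rightarrow> real set \<Rightarrow> (real set \<times> real list) pmf" where
  "arrival k X =
     do {
       S \<leftarrow> pmf_of_set {S. S \<subseteq> X \<and> card S = k};
       xs \<leftarrow> pmf_of_set (permutations_of_set (X - S));
       return_pmf (S, xs)
     }"

text \<open>
  A deterministic policy \<open>\<pi>\<close> decides, as long as nothing has been selected, whether to select the
  current secretary: \<open>\<pi> S ys\<close> is the decision at time \<open>length ys\<close>, where the nonempty list \<open>ys\<close>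
  consists of the secretaries seen so far, \<open>last ys\<close> being the current one. That only the relative
  order of \<open>S\<close> and \<open>ys\<close> is known is expressed by invariance under order embeddings.
\<close>

type_synonym policy = "real set \<Rightarrow> real list \<Rightarrow> bool"

definition order_based :: "policy \<Rightarrow> bool" where
  "order_based \<pi> \<longleftrightarrow>
     (\<forall>S ys f. ys \<noteq> [] \<longrightarrow> strict_mono_on (S \<union> set ys) f \<longrightarrow> \<pi> (f ` S) (map f ys) = \<pi> S ys)"

text \<open>Times are counted from 1, so the secretary arriving at time \<open>i\<close> is \<open>xs ! (i - 1)\<close>.\<close>

definition stops_at :: "policy \<Rightarrow> real set \<Rightarrow> real list \<Rightarrow> nat \<Rightarrow> bool" where
  "stops_at \<pi> S xs i \<longleftrightarrow>
     i \<in> {1..length xs} \<and> \<pi> S (take i xs) \<and> (\<forall>j\<in>{1..<i}. \<not> \<pi> S (take j xs))"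

definition wins :: "policy \<Rightarrow> real set \<Rightarrow> real list \<Rightarrow> bool" where
  "wins \<pi> S xs \<longleftrightarrow> (\<exists>i. stops_at \<pi> S xs i \<and> xs ! (i - 1) = Max (set xs))"

definition win_prob :: "nat \<Rightarrow> real set \<Rightarrow> policy \<Rightarrow> real" where
  "win_prob k X \<pi> = measure_pmf.prob (arrival k X) {(S, xs). wins \<pi> S xs}"

text \<open>
  A randomized policy is a probability distribution over deterministic policies, drawn independently
  of the arrival process. Randomization by an arbitrary private random seed has this form: take the
  distribution of the resulting deterministic policy.
\<close>

definition randomized_policy :: "policy measure \<Rightarrow> bool" where
  "randomized_policy M \<longleftrightarrow>
     prob_space M \<and> (\<forall>\<pi>\<in>space M. order_based \<pi>) \<and>
     (\<forall>S ys. {\<pi> \<in> space M. \<pi> S ys} \<in> sets M)"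

definition randomized_win_prob :: "nat \<Rightarrow> real set \<Rightarrow> policy measure \<Rightarrow> real" where
  "randomized_win_prob k X M = (\<integral>\<pi>. win_prob k X \<pi> \<partial>M)"

text \<open>
  The winning probability of an order-based policy does not depend on the numbers chosen by the
  adversary; optimality is required for every choice.
\<close>

definition optimal_policy :: "nat \<Rightarrow> nat \<Rightarrow> policy \<Rightarrow> bool" where
  "optimal_policy n k \<pi> \<longleftrightarrow>
     order_based \<pi> \<and>
     (\<forall>X M. finite X \<longrightarrow> card X = n + k \<longrightarrow> randomized_policy M \<longrightarrow>
        randomized_win_prob k X M \<le> win_prob k X \<pi>)"

definition signal :: "real set \<Rightarrow> real \<Rightarrow> nat" where
  "signal S y = card {x \<in> S. x < y}"

definition best_so_far :: "real list \<Rightarrow> bool" where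
  "best_so_far ys \<longleftrightarrow> (\<forall>y\<in>set (butlast ys). y < last ys)"

definition threshold_policy :: "(nat \<Rightarrow> nat) \<Rightarrow> policy" where
  "threshold_policy t S ys \<longleftrightarrow> best_so_far ys \<and> length ys \<ge> t (signal S (last ys))"

end

theory Submission
  imports Defs
begin

text \<open>
  Only the relative order matters, so an arrival can be generated by inserting each new secretary at
  a uniformly random position among the \<open>k + i\<close> numbers seen before. If \<open>m\<close> samples lie below the
  best of the first \<open>i\<close> secretaries, then \<open>i + m\<close> of the \<open>k + i + 1\<close> insertion positions leave this
  secretary the best one, and each of the others yields a new best secretary, with the signals
  \<open>m, \<dots>, k\<close> once each. Counting winning continuations therefore gives a dynamic program in \<open>(i, m)\<close>.
  Let \<open>K i m\<close> and \<open>V i m\<close> be the numbers of winning continuations when the current best secretary is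
  selected, respectively rejected. Then
  \<open>K i m = (i + m) * K (i + 1) m\<close> and \<open>V i m \<ge> (i + m) * V (i + 1) m\<close>, so \<open>V i m \<le> K i m\<close> implies
  \<open>V (i + 1) m \<le> K (i + 1) m\<close>: once it is optimal to select a best-so-far secretary with a given
  signal, it remains so.
\<close>

section \<open>Arrivals as uniformly random configurations\<close>

definition configs :: "nat \<Rightarrow> 'a set \<Rightarrow> ('a set \<times> 'a list) set" where
  "configs k X = {(S, xs). S \<subseteq> X \<and> card S = k \<and> xs \<in> permutations_of_set (X - S)}"

lemma finite_configs [simp]: "finite X \<Longrightarrow> finite (configs k X)"
  by (rule finite_subset[of _ "Pow X \<times> (\<Union>S\<in>Pow X. permutations_of_set (X - S))"])
     (auto simp: configs_def)

text \<open>Every sample set leaves equally many arrival orders, \<open>fact (card X - k)\<close>,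
  so drawing the samples first and the order second is uniform on the disjoint union of the fibres
  \<open>?f S\<close>.\<close>

lemma arrival_eq_pmf_of_set:
  assumes "finite X" "k \<le> card X"
  shows "arrival k X = pmf_of_set (configs k X)"
    and "configs k X \<noteq> {}"
proof -
  let ?A = "{S. S \<subseteq> X \<and> card S = k}"
  let ?f = "\<lambda>S. Pair S ` permutations_of_set (X - S)"
  have eq: "configs k X = (\<Union>S\<in>?A. ?f S)"
    by (auto simp: configs_def)
  have ne: "?A \<noteq> {}"
    using obtain_subset_with_card_n[OF assms(2)] by blast
  have fin: "finite ?A"
    using assms by simp
  show "configs k X \<noteq> {}"
    using ne assms unfolding eq by auto
  have "pmf_of_set (\<Union>S\<in>?A. ?f S) = do {S \<leftarrow> pmf_of_set ?A; pmf_of_set (?f S)}"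
  proof (rule pmf_of_set_UN)
    show "finite (\<Union>S\<in>?A. ?f S)"
      using assms by (metis eq finite_configs)
    show "\<And>S. S \<in> ?A \<Longrightarrow> ?f S \<noteq> {}"
      using assms by auto
    show "\<And>S. S \<in> ?A \<Longrightarrow> card (?f S) = fact (card X - k)"
      using assms
      by (auto simp: card_image inj_on_def card_Diff_subset finite_subset)
    show "disjoint_family_on ?f ?A"
      by (auto simp: disjoint_family_on_def)
  qed (use ne in auto)
  also have "\<dots> = arrival k X"
    unfolding arrival_def
  proof (rule bind_pmf_cong[OF refl])
    fix S
    have "pmf_of_set (?f S) = map_pmf (Pair S) (pmf_of_set (permutations_of_set (X - S)))"
      using assms by (subst map_pmf_of_set_inj) (auto simp: inj_on_def)
    then show "pmf_of_set (?f S) =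
        pmf_of_set (permutations_of_set (X - S)) \<bind> (\<lambda>xs. return_pmf (S, xs))"
      by (simp add: map_pmf_def)
  qed
  finally show "arrival k X = pmf_of_set (configs k X)"
    by (simp add: eq)
qed

text \<open>Serves both to pass from \<open>X\<close> to ranks and to renormalise ranks after an
  insertion.\<close>

lemma configs_image:
  assumes "inj_on f X"
  shows "bij_betw (\<lambda>(S, xs). (f ` S, map f xs)) (configs k X) (configs k (f ` X))"
  unfolding bij_betw_def
proof
  show "inj_on (\<lambda>(S, xs). (f ` S, map f xs)) (configs k X)"
  proof (rule inj_onI, clarify)
    fix S xs T ys
    assume c: "(S, xs) \<in> configs k X" "(T, ys) \<in> configs k X"
      and eq: "f ` S = f ` T" "map f xs = map f ys"
    have "S = T"
      using c eq(1) assms by (auto simp: configs_def inj_on_image_eq_iff)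
    moreover have "xs = ys"
    proof (rule map_inj_on[OF eq(2)])
      show "inj_on f (set xs \<union> set ys)"
        using c by (intro inj_on_subset[OF assms]) (auto simp: configs_def permutations_of_set_def)
    qed
    ultimately show "S = T \<and> xs = ys" by simp
  qed
  show "(\<lambda>(S, xs). (f ` S, map f xs)) ` configs k X = configs k (f ` X)"
  proof (intro equalityI subsetI)
    fix c assume "c \<in> (\<lambda>(S, xs). (f ` S, map f xs)) ` configs k X"
    then obtain S xs where c: "c = (f ` S, map f xs)" and S: "S \<subseteq> X" "card S = k"
      and xs: "xs \<in> permutations_of_set (X - S)"
      by (auto simp: configs_def)
    have "f ` X - f ` S = f ` (X - S)"
      using inj_on_image_set_diff[OF assms, of X S] S by auto
    moreover have "inj_on f (X - S)"
      using assms by (rule inj_on_subset) auto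
    ultimately have "map f xs \<in> permutations_of_set (f ` X - f ` S)"
      using xs by (simp add: permutations_of_set_image_inj)
    then show "c \<in> configs k (f ` X)"
      using S c assms by (auto simp: configs_def card_image inj_on_subset)
  next
    fix c assume "c \<in> configs k (f ` X)"
    then obtain T zs where c: "c = (T, zs)" and T: "T \<subseteq> f ` X" "card T = k"
      and zs: "zs \<in> permutations_of_set (f ` X - T)"
      by (auto simp: configs_def)
    obtain S where S: "S \<subseteq> X" "T = f ` S"
      using T(1) by (auto elim: subset_imageE)
    have "f ` X - f ` S = f ` (X - S)"
      using inj_on_image_set_diff[OF assms, of X S] S by auto
    moreover have "inj_on f (X - S)"
      using assms by (rule inj_on_subset) auto
    ultimately obtain xs where "xs \<in> permutations_of_set (X - S)" "zs = map f xs"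
      using zs S by (auto simp: permutations_of_set_image_inj)
    moreover have "card S = k"
      using T(2) S assms by (simp add: card_image inj_on_subset)
    ultimately show "c \<in> (\<lambda>(S, xs). (f ` S, map f xs)) ` configs k X"
      using S c by (auto simp: configs_def)
  qed
qed

text \<open>Basis of the recursion on the number of secretaries: any number can come last, after an
  arbitrary configuration on the rest. The bound \<open>k < card X\<close> guarantees that there is
  a last secretary.\<close>

lemma configs_append_last:
  assumes "finite X" "k < card X"
  shows "bij_betw (\<lambda>(y, S, ys). (S, ys @ [y])) (SIGMA y:X. configs k (X - {y})) (configs k X)"
  unfolding bij_betw_def
proof
  show "inj_on (\<lambda>(y, S, ys). (S, ys @ [y])) (SIGMA y:X. configs k (X - {y}))"
    by (auto simp: inj_on_def)
  show "(\<lambda>(y, S, ys). (S, ys @ [y])) ` (SIGMA y:X. configs k (X - {y})) = configs k X"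
  proof (intro equalityI subsetI)
    fix c assume "c \<in> (\<lambda>(y, S, ys). (S, ys @ [y])) ` (SIGMA y:X. configs k (X - {y}))"
    then show "c \<in> configs k X"
      by (auto simp: configs_def permutations_of_set_def)
  next
    fix c assume c: "c \<in> configs k X"
    then obtain S zs where S: "c = (S, zs)" "S \<subseteq> X" "card S = k" "set zs = X - S" "distinct zs"
      by (auto simp: configs_def permutations_of_set_def)
    have "zs \<noteq> []"
      using S assms by auto
    then obtain ys y where zs: "zs = ys @ [y]"
      by (metis rev_exhaust)
    then have "y \<in> X" "(S, ys) \<in> configs k (X - {y})"
      using S by (auto simp: configs_def permutations_of_set_def)
    then show "c \<in> (\<lambda>(y, S, ys). (S, ys @ [y])) ` (SIGMA y:X. configs k (X - {y}))"
      unfolding S(1) zs by (intro image_eqI[of _ _ "(y, S, ys)"]) auto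
  qed
qed

section \<open>Insertion of the next secretary\<close>

text \<open>Configurations on \<open>initial N\<close> are canonical representatives of relative
  orders: each number is its own rank, counted from 0.\<close>

abbreviation initial :: "nat \<Rightarrow> real set" where
  "initial N \<equiv> real ` {..<N}"

text \<open>Frees the rank \<open>g\<close> for a newcomer while the old numbers keep their relative
  order.\<close>

definition bump :: "nat \<Rightarrow> real \<Rightarrow> real" where
  "bump g x = (if x < real g then x else x + 1)"

lemma bump_less_iff [simp]: "bump g x < bump g y \<longleftrightarrow> x < y"
  by (auto simp: bump_def)

lemma bump_eq_iff [simp]: "bump g x = bump g y \<longleftrightarrow> x = y"
  by (auto simp: bump_def)

lemma strict_mono_on_bump: "strict_mono_on A (bump g)"
  by (simp add: strict_mono_on_def)

lemma inj_on_bump: "inj_on (bump g) A"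
  by (simp add: inj_on_def)

lemma bump_of_nat: "bump g (real j) = real (if j < g then j else Suc j)"
  by (simp add: bump_def)

lemma initial_diff:
  assumes "g \<le> N"
  shows "initial (Suc N) - {real g} = bump g ` initial N"
proof -
  have "{..<Suc N} - {g} = (\<lambda>j. if j < g then j else Suc j) ` {..<N}"
  proof (intro equalityI subsetI)
    fix j assume "j \<in> {..<Suc N} - {g}"
    then have "(if j < g then j else j - 1) < N"
      "j = (\<lambda>j. if j < g then j else Suc j) (if j < g then j else j - 1)"
      using assms by auto
    then show "j \<in> (\<lambda>j. if j < g then j else Suc j) ` {..<N}"
      by blast
  qed auto
  then have "real ` ({..<Suc N} - {g}) = bump g ` initial N"
    unfolding image_image bump_of_nat by (simp only: image_image)
  then show ?thesis
    by (simp add: image_set_diff[OF inj_of_nat] del: lessThan_Suc)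
qed

text \<open>Conditions on the rank \<open>g\<close> of the last secretary. Once it is removed, the
  remaining ranks have a gap at \<open>g\<close> and form the image of
  \<open>initial (k + i)\<close> under \<open>bump g\<close>.\<close>

lemma sum_configs_Suc:
  "(\<Sum>(S, ys)\<in>configs k (initial (Suc (k + i))). h S ys) =
   (\<Sum>(S, ys)\<in>configs k (initial (k + i)). \<Sum>g\<le>k + i. h (bump g ` S) (map (bump g) ys @ [real g]))"
proof -
  let ?X = "initial (Suc (k + i))"
  have card: "card ?X = Suc (k + i)"
    by (simp add: card_image)
  have "(\<Sum>(S, ys)\<in>configs k ?X. h S ys) =
      (\<Sum>(y, S, ys)\<in>(SIGMA y:?X. configs k (?X - {y})). h S (ys @ [y]))"
    using sum.reindex_bij_betw[OF configs_append_last[of ?X k], of "\<lambda>(S, ys). h S ys"] card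
    by (simp add: case_prod_beta' del: card_lessThan)
  also have "\<dots> = (\<Sum>y\<in>?X. \<Sum>(S, ys)\<in>configs k (?X - {y}). h S (ys @ [y]))"
    by (subst sum.Sigma) (auto simp: case_prod_beta')
  also have "\<dots> = (\<Sum>g\<le>k + i. \<Sum>(S, ys)\<in>configs k (?X - {real g}). h S (ys @ [real g]))"
    by (subst sum.reindex) (auto simp: lessThan_Suc_atMost)
  also have "\<dots> = (\<Sum>g\<le>k + i. \<Sum>(S, ys)\<in>configs k (initial (k + i)).
      h (bump g ` S) (map (bump g) ys @ [real g]))"
  proof (rule sum.cong[OF refl])
    fix g assume "g \<in> {..k + i}"
    then have eq: "?X - {real g} = bump g ` initial (k + i)"
      by (intro initial_diff) auto
    show "(\<Sum>(S, ys)\<in>configs k (?X - {real g}). h S (ys @ [real g])) =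
        (\<Sum>(S, ys)\<in>configs k (initial (k + i)). h (bump g ` S) (map (bump g) ys @ [real g]))"
      unfolding eq
      using sum.reindex_bij_betw[OF configs_image[OF inj_on_bump[of g "initial (k + i)"], of k],
          of "\<lambda>(S, ys). h S (ys @ [real g])"]
      by (simp add: case_prod_beta')
  qed
  also have "\<dots> = (\<Sum>(S, ys)\<in>configs k (initial (k + i)).
      \<Sum>g\<le>k + i. h (bump g ` S) (map (bump g) ys @ [real g]))"
    by (subst sum.swap) (simp add: case_prod_beta')
  finally show ?thesis .
qed

text \<open>Total of \<open>h\<close> over all ways to insert \<open>r\<close> further secretaries,
  with ranks renormalised at each insertion. For the indicator of winning it counts winning
  continuations.\<close>

fun completions :: "(real set \<Rightarrow> real list \<Rightarrow> nat) \<Rightarrow> nat \<Rightarrow> nat \<Rightarrow> real set \<Rightarrow> real list \<Rightarrow> nat" where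
  "completions h k 0 S ys = h S ys"
| "completions h k (Suc r) S ys =
     (\<Sum>g\<le>k + length ys. completions h k r (bump g ` S) (map (bump g) ys @ [real g]))"

lemma configs_initialD:
  assumes "(S, ys) \<in> configs k (initial (k + i))"
  shows "length ys = i" "S \<inter> set ys = {}" "S \<union> set ys = initial (k + i)" "distinct ys"
    "finite S" "card S = k"
proof -
  have S: "S \<subseteq> initial (k + i)" "card S = k" and ys: "set ys = initial (k + i) - S" "distinct ys"
    using assms by (auto simp: configs_def permutations_of_set_def)
  show fin: "finite S"
    using S(1) by (rule finite_subset) simp
  show "length ys = i"
    using S ys fin by (simp add: card_Diff_subset card_image flip: distinct_card)
  show "S \<inter> set ys = {}" "S \<union> set ys = initial (k + i)" "distinct ys" "card S = k"
    using S ys by auto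
qed

lemma insert_in_configs:
  assumes "(S, ys) \<in> configs k (initial (k + i))" "g \<le> k + i"
  shows "(bump g ` S, map (bump g) ys @ [real g]) \<in> configs k (initial (k + Suc i))"
proof -
  have "(bump g ` S, map (bump g) ys) \<in> configs k (bump g ` initial (k + i))"
    using bij_betw_apply[OF configs_image[OF inj_on_bump] assms(1)] by simp
  then have "(bump g ` S, map (bump g) ys) \<in> configs k (initial (Suc (k + i)) - {real g})"
    using initial_diff[OF assms(2)] by simp
  then show ?thesis
    using assms(2)
    by (auto simp: configs_def permutations_of_set_def less_Suc_eq_le
        simp del: image_insert lessThan_Suc)
qed

text \<open>Each insertion is an instance of \<open>sum_configs_Suc\<close>. At \<open>i = 0\<close>
  the left side has a single summand, so the completions of the start sum over all full
  arrivals.\<close>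

lemma sum_completions:
  "(\<Sum>(S, ys)\<in>configs k (initial (k + i)). completions h k r S ys) =
   (\<Sum>(S, ys)\<in>configs k (initial (k + (i + r))). h S ys)"
proof (induction r arbitrary: i)
  case 0
  show ?case by simp
next
  case (Suc r)
  have "(\<Sum>(S, ys)\<in>configs k (initial (k + i)). completions h k (Suc r) S ys) =
      (\<Sum>(S, ys)\<in>configs k (initial (k + i)).
        \<Sum>g\<le>k + i. completions h k r (bump g ` S) (map (bump g) ys @ [real g]))"
    by (rule sum.cong) (auto dest: configs_initialD(1))
  also have "\<dots> = (\<Sum>(S, ys)\<in>configs k (initial (k + Suc i)). completions h k r S ys)"
    by (simp add: sum_configs_Suc del: lessThan_Suc)
  also have "\<dots> = (\<Sum>(S, ys)\<in>configs k (initial (k + (i + Suc r))). h S ys)"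
    using Suc.IH[of "Suc i"] by (simp del: lessThan_Suc)
  finally show ?case .
qed

lemma configs_initial_self: "configs k (initial k) = {(initial k, [])}"
proof -
  have "S = initial k" if "S \<subseteq> initial k" "card S = k" for S
    using that by (intro card_subset_eq) (auto simp: card_image)
  then have "{S. S \<subseteq> initial k \<and> card S = k} = {initial k}"
    by (auto simp: card_image)
  moreover have "configs k (initial k) =
      (SIGMA S:{S. S \<subseteq> initial k \<and> card S = k}. permutations_of_set (initial k - S))"
    by (auto simp: configs_def)
  ultimately show ?thesis
    by auto
qed

section \<open>The winning probability of an order-based policy\<close>

text \<open>An order-based policy stops at the same time after an increasing relabelling, and the
  maximum is carried to the maximum.\<close>

lemma wins_map:
  assumes "order_based \<pi>" "strict_mono_on (S \<union> set xs) f"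
  shows "wins \<pi> (f ` S) (map f xs) \<longleftrightarrow> wins \<pi> S xs"
proof -
  have take: "\<pi> (f ` S) (map f (take i xs)) = \<pi> S (take i xs)" if "i \<ge> 1" "i \<le> length xs" for i
  proof -
    have "strict_mono_on (S \<union> set (take i xs)) f"
      using assms(2) by (rule monotone_on_subset) (auto dest: in_set_takeD)
    moreover have "take i xs \<noteq> []"
      using that by auto
    ultimately show ?thesis
      using assms(1) unfolding order_based_def by blast
  qed
  have stops: "stops_at \<pi> (f ` S) (map f xs) i \<longleftrightarrow> stops_at \<pi> S xs i" for i
    unfolding stops_at_def by (auto simp: take_map take)
  have "map f xs ! (i - 1) = Max (set (map f xs)) \<longleftrightarrow> xs ! (i - 1) = Max (set xs)"
    if "stops_at \<pi> S xs i" for i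
  proof -
    have i: "i - 1 < length xs"
      using that by (auto simp: stops_at_def)
    then have ne: "set xs \<noteq> {}" by auto
    have mono: "strict_mono_on (set xs) f"
      using assms(2) by (rule monotone_on_subset) auto
    have "Max (f ` set xs) = f (Max (set xs))"
      using ne mono strict_mono_on_leD[OF mono]
      by (intro Max_eqI) auto
    moreover have "f (xs ! (i - 1)) = f (Max (set xs)) \<longleftrightarrow> xs ! (i - 1) = Max (set xs)"
      using i ne strict_mono_on_imp_inj_on[OF mono] by (auto simp: inj_on_eq_iff)
    ultimately show ?thesis
      using i by simp
  qed
  then show ?thesis
    unfolding wins_def using stops by blast
qed

lemma obtain_strict_mono_initial:
  assumes "finite X"
  obtains f where "strict_mono_on (initial (card X)) f" "f ` initial (card X) = (X :: real set)"
proof -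
  let ?xs = "sorted_list_of_set X"
  \<comment> \<open>\<open>?xs\<close> lists the numbers by rank; the floor turns a rank given as a
    real back into a list index.\<close>
  let ?f = "\<lambda>x. ?xs ! nat \<lfloor>x\<rfloor>"
  have "strict_mono_on (initial (card X)) ?f"
    using assms strict_sorted_list_of_set[of X]
    by (auto simp: strict_mono_on_def sorted_wrt_iff_nth_less)
  moreover have "?f ` initial (card X) = X"
    using assms nth_image[of "length ?xs" ?xs]
    by (simp add: image_image lessThan_atLeast0)
  ultimately show ?thesis
    using that by blast
qed

text \<open>Turns optimality into a counting problem: configurations on \<open>X\<close> are
  transported to ranks, where every arrival completes the start with samples
  \<open>initial k\<close> and no secretaries. The denominator is the same for all policies.\<close>

lemma win_prob_eq_completions:
  assumes "order_based \<pi>" "finite X" "card X = n + k"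
  shows "win_prob k X \<pi> =
    real (completions (\<lambda>S xs. of_bool (wins \<pi> S xs)) k n (initial k) []) / real (card (configs k X))"
proof -
  let ?h = "\<lambda>S xs. of_bool (wins \<pi> S xs) :: nat"
  note arr = arrival_eq_pmf_of_set[of X k]
  have "win_prob k X \<pi> =
      real (card (configs k X \<inter> {(S, xs). wins \<pi> S xs})) / real (card (configs k X))"
    unfolding win_prob_def using assms arr by (simp add: measure_pmf_of_set)
  also have "card (configs k X \<inter> {(S, xs). wins \<pi> S xs}) = (\<Sum>(S, xs)\<in>configs k X. ?h S xs)"
    using sum_of_bool_eq[of "configs k X" "\<lambda>(S, xs). wins \<pi> S xs", where 'a = nat] assms(2)
    by (simp add: case_prod_beta')
  also have "\<dots> = (\<Sum>(S, xs)\<in>configs k (initial (k + n)). ?h S xs)"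
  proof -
    obtain f where f: "strict_mono_on (initial (n + k)) f" "f ` initial (n + k) = X"
      using obtain_strict_mono_initial[OF assms(2)] assms(3) by metis
    have "(\<Sum>(S, xs)\<in>configs k X. ?h S xs) =
        (\<Sum>(S, xs)\<in>configs k (initial (n + k)). ?h (f ` S) (map f xs))"
      using sum.reindex_bij_betw[OF configs_image[OF strict_mono_on_imp_inj_on[OF f(1)], of k],
          of "\<lambda>(S, xs). ?h S xs"] f(2)
      by (simp add: case_prod_beta')
    also have "\<dots> = (\<Sum>(S, xs)\<in>configs k (initial (n + k)). ?h S xs)"
    proof (rule sum.cong[OF refl], clarify)
      fix S xs assume "(S, xs) \<in> configs k (initial (n + k))"
      then have "S \<union> set xs \<subseteq> initial (n + k)"
        by (auto simp: configs_def permutations_of_set_def)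
      then show "?h (f ` S) (map f xs) = ?h S xs"
        using wins_map[OF assms(1)] monotone_on_subset[OF f(1)] by simp
    qed
    finally show ?thesis by (simp add: add.commute)
  qed
  also have "\<dots> = completions ?h k n (initial k) []"
    using sum_completions[where i = 0 and k = k and r = n and h = ?h]
    by (simp add: configs_initial_self)
  finally show ?thesis .
qed

section \<open>The dynamic program\<close>

text \<open>
  For \<open>ys = []\<close> the value is chosen such that the first secretary becomes the best one at each
  insertion position.
\<close>

definition best_signal :: "real set \<Rightarrow> real list \<Rightarrow> nat" where
  "best_signal S ys = (if ys = [] then 0 else signal S (Max (set ys)))"

lemma signal_image:
  assumes "strict_mono_on (insert y S) f"
  shows "signal (f ` S) (f y) = signal S y"
proof -
  have "{x \<in> f ` S. x < f y} = f ` {x \<in> S. x < y}"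
    using strict_mono_on_less[OF assms] by auto
  moreover have "inj_on f {x \<in> S. x < y}"
    using strict_mono_on_imp_inj_on[OF assms] by (rule inj_on_subset) auto
  ultimately show ?thesis
    by (simp add: signal_def card_image)
qed

lemma Max_bump:
  assumes "ys \<noteq> []"
  shows "Max (bump g ` set ys) = bump g (Max (set ys))"
proof (rule Max_eqI)
  fix y assume "y \<in> bump g ` set ys"
  then obtain x where "x \<in> set ys" "y = bump g x" by auto
  moreover from this have "x \<le> Max (set ys)" by simp
  ultimately show "y \<le> bump g (Max (set ys))"
    unfolding bump_def by (smt (verit))
qed (use assms in auto)

section \<open>Effect of an insertion on the best secretary and its signal\<close>

context
  fixes k i :: nat and S :: "real set" and ys :: "real list"
  assumes conf: "(S, ys) \<in> configs k (initial (k + i))"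
begin

text \<open>Below the best of \<open>i\<close> secretaries lie the other \<open>i - 1\<close>
  secretaries and \<open>best_signal S ys\<close> samples, which determines its rank. The form with
  \<open>Suc\<close> avoids a truncated subtraction.\<close>

lemma Max_eq_best_signal:
  assumes "ys \<noteq> []"
  shows "Suc (nat \<lfloor>Max (set ys)\<rfloor>) = i + best_signal S ys" "real (nat \<lfloor>Max (set ys)\<rfloor>) = Max (set ys)"
proof -
  note c = configs_initialD[OF conf]
  have M: "Max (set ys) \<in> set ys"
    using assms by simp
  then obtain q where q: "Max (set ys) = real q" "q < k + i"
    using c(3) by (metis UnCI imageE lessThan_iff)
  then show "real (nat \<lfloor>Max (set ys)\<rfloor>) = Max (set ys)" by simp
  \<comment> \<open>The numbers below \<open>q\<close> are counted in two ways: there are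
    \<open>q\<close> of them, and they are samples or secretaries other than the best.\<close>
  have "initial q = {x \<in> S \<union> set ys. x < real q}"
    using q c(3) by auto
  also have "\<dots> = {x \<in> S. x < real q} \<union> (set ys - {real q})"
  proof -
    have "\<And>x. x \<in> set ys \<Longrightarrow> x \<le> real q"
      using q(1) by (metis List.finite_set Max_ge)
    then show ?thesis by force
  qed
  finally have "card (initial q) = card \<dots>" by simp
  also have "\<dots> = card {x \<in> S. x < real q} + card (set ys - {real q})"
    using c by (intro card_Un_disjoint) auto
  also have "card (set ys - {real q}) = i - 1"
    using M q c by (simp add: distinct_card)
  finally have "q = best_signal S ys + (i - 1)"
    using assms q by (simp add: card_image best_signal_def signal_def)
  moreover have "i > 0"
    using assms c(1) by auto
  ultimately show "Suc (nat \<lfloor>Max (set ys)\<rfloor>) = i + best_signal S ys"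
    using q by simp
qed

lemma best_signal_le: "best_signal S ys \<le> k"
  using configs_initialD[OF conf]
  by (auto simp: best_signal_def signal_def intro: order.trans[OF card_mono[of S]])

text \<open>The best secretary has rank \<open>i + best_signal S ys - 1\<close>; a newcomer placed
  at exactly this rank still pushes it up and stays below it.\<close>

lemma less_iff_le_Max:
  assumes "ys \<noteq> []"
  shows "g < i + best_signal S ys \<longleftrightarrow> real g \<le> Max (set ys)"
  using Max_eq_best_signal[OF assms] by (metis less_Suc_eq_le of_nat_le_iff)

context
  fixes g :: nat
  assumes g: "g \<le> k + i"
begin

lemma insert_below:
  assumes "g < i + best_signal S ys"
  shows "ys \<noteq> []"
    and "Max (set (map (bump g) ys @ [real g])) = bump g (Max (set ys))"
    and "\<not> best_so_far (map (bump g) ys @ [real g])"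
    and "best_signal (bump g ` S) (map (bump g) ys @ [real g]) = best_signal S ys"
proof -
  \<comment> \<open>Without secretaries both \<open>i\<close> and \<open>best_signal S ys\<close>
    are 0, and no \<open>g\<close> satisfies the bound.\<close>
  show ne: "ys \<noteq> []"
    using assms configs_initialD(1)[OF conf] by (auto simp: best_signal_def)
  have le: "real g \<le> Max (set ys)"
    using assms less_iff_le_Max[OF ne] by simp
  then have less: "real g < bump g (Max (set ys))"
    by (simp add: bump_def)
  then show M: "Max (set (map (bump g) ys @ [real g])) = bump g (Max (set ys))"
    using ne by (simp add: Max_bump max_def)
  have "bump g (Max (set ys)) \<in> bump g ` set ys"
    using ne by simp
  then show "\<not> best_so_far (map (bump g) ys @ [real g])"
    using less unfolding best_so_far_def by force
  show "best_signal (bump g ` S) (map (bump g) ys @ [real g]) = best_signal S ys"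
    unfolding best_signal_def M using ne signal_image[OF strict_mono_on_bump] by simp
qed

text \<open>A newcomer of rank \<open>g\<close> has \<open>g\<close> numbers below it; as these
  include all \<open>i\<close> old secretaries, \<open>g - i\<close> of them are samples.\<close>

lemma insert_above:
  assumes "\<not> g < i + best_signal S ys"
  shows "Max (set (map (bump g) ys @ [real g])) = real g"
    and "x \<in> set ys \<Longrightarrow> bump g x < real g"
    and "best_so_far (map (bump g) ys @ [real g])"
    and "best_signal (bump g ` S) (map (bump g) ys @ [real g]) = g - i"
    and "signal (bump g ` S) (real g) = g - i"
proof -
  show less: "bump g x < real g" if "x \<in> set ys" for x
  proof -
    have "ys \<noteq> []"
      using that by auto
    then have "Max (set ys) < real g"
      using less_iff_le_Max[of g] assms by (metis not_le)
    moreover have "x \<le> Max (set ys)"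
      using that by simp
    ultimately show ?thesis
      by (simp add: bump_def)
  qed
  show M: "Max (set (map (bump g) ys @ [real g])) = real g"
    using less by (intro Max_eqI) (auto intro: less_imp_le)
  show "best_so_far (map (bump g) ys @ [real g])"
    using less by (auto simp: best_so_far_def)
  note c = configs_initialD[OF insert_in_configs[OF conf g]]
  have "initial g = {x \<in> bump g ` S \<union> set (map (bump g) ys @ [real g]). x < real g}"
    unfolding c(3) using g by auto
  also have "\<dots> = {x \<in> bump g ` S. x < real g} \<union> set (map (bump g) ys)"
    using less by auto
  finally have "card (initial g) = card \<dots>" by simp
  also have "\<dots> = card {x \<in> bump g ` S. x < real g} + card (set (map (bump g) ys))"
    using c by (intro card_Un_disjoint) auto
  also have "card (set (map (bump g) ys)) = i"
    using c configs_initialD[OF conf] by (simp add: distinct_card del: set_map)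
  finally show signal: "signal (bump g ` S) (real g) = g - i"
    by (simp add: card_image signal_def)
  then show "best_signal (bump g ` S) (map (bump g) ys @ [real g]) = g - i"
    unfolding best_signal_def M by simp
qed

end

end

text \<open>
  \<open>select_count k r i m\<close> and \<open>reject_count k r i m\<close> are \<open>K i m\<close> and \<open>V i m\<close> above, where \<open>r\<close> is the
  number of secretaries still to come.
\<close>

fun select_count :: "nat \<Rightarrow> nat \<Rightarrow> nat \<Rightarrow> nat \<Rightarrow> nat" where
  "select_count k 0 i m = 1"
| "select_count k (Suc r) i m = (i + m) * select_count k r (Suc i) m"

fun reject_count :: "nat \<Rightarrow> nat \<Rightarrow> nat \<Rightarrow> nat \<Rightarrow> nat" where
  "reject_count k 0 i m = 0"
| "reject_count k (Suc r) i m = (i + m) * reject_count k r (Suc i) m +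
     (\<Sum>s=m..k. max (select_count k r (Suc i) s) (reject_count k r (Suc i) s))"

text \<open>Common shape of both recursions: the first \<open>i + m\<close> positions keep the best
  secretary, and the others are indexed by the new signal \<open>s = g - i\<close>, which runs from
  \<open>m\<close> to \<open>k\<close>.\<close>

lemma sum_insertions:
  assumes "m \<le> k"
  shows "(\<Sum>g\<le>k + i. if g < i + m then a else f (g - i)) = (i + m) * a + (\<Sum>s=m..k. f s :: nat)"
proof -
  have "{..k + i} \<inter> {g. g < i + m} = {..<i + m}"
    using assms by auto
  moreover have "{..k + i} \<inter> - {g. g < i + m} = {m + i..k + i}"
    by auto
  moreover have "(\<Sum>g=m + i..k + i. f (g - i)) = (\<Sum>s=m..k. f s)"
    by (simp add: sum.shift_bounds_cl_nat_ivl)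
  ultimately show ?thesis
    by (simp add: sum.If_cases)
qed

section \<open>Order-based policies against the dynamic program\<close>

context
  fixes \<pi> :: policy
  assumes ob: "order_based \<pi>"
begin

text \<open>\<open>bump g\<close> keeps the relative order of the numbers seen before, so
  renormalising leaves past decisions intact.\<close>

lemma policy_take_insert:
  assumes "j \<in> {1..length ys}"
  shows "\<pi> (bump g ` S) (take j (map (bump g) ys @ [x])) = \<pi> S (take j ys)"
proof -
  have "take j ys \<noteq> []"
    using assms by auto
  then have "\<pi> (bump g ` S) (map (bump g) (take j ys)) = \<pi> S (take j ys)"
    using ob strict_mono_on_bump unfolding order_based_def by blast
  then show ?thesis
    using assms by (simp add: take_map)
qed

lemma stops_at_insert:
  "stops_at \<pi> S ys j \<Longrightarrow> stops_at \<pi> (bump g ` S) (map (bump g) ys @ [x]) j"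
  using policy_take_insert[of _ ys g S x] unfolding stops_at_def by auto

lemma stops_at_unique: "stops_at \<pi> S ys i \<Longrightarrow> stops_at \<pi> S ys j \<Longrightarrow> i = j"
  unfolding stops_at_def by (metis atLeastAtMost_iff atLeastLessThan_iff linorder_neqE_nat)

text \<open>After stopping, an insertion below the best secretary changes nothing essential, while
  one above it beats the selected secretary for good. If the best one was selected, the count is
  thus the product of the numbers of harmless positions.\<close>

lemma completions_stopped:
  assumes "(S, ys) \<in> configs k (initial (k + i))" "stops_at \<pi> S ys j"
  shows "completions (\<lambda>S xs. of_bool (wins \<pi> S xs)) k r S ys =
    (if ys ! (j - 1) = Max (set ys) then select_count k r i (best_signal S ys) else 0)"
  using assms
proof (induction r arbitrary: S ys i)
  case 0
  then have "wins \<pi> S ys \<longleftrightarrow> ys ! (j - 1) = Max (set ys)"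
    unfolding wins_def using stops_at_unique by blast
  then show ?case by simp
next
  case (Suc r)
  note c = Suc.prems(1)
  let ?m = "best_signal S ys"
  let ?ins = "\<lambda>g. map (bump g) ys @ [real g]"
  have len: "length ys = i"
    using c by (rule configs_initialD)
  have j: "j - 1 < length ys"
    using Suc.prems(2) by (auto simp: stops_at_def)
  let ?win = "ys ! (j - 1) = Max (set ys)"
  have "completions (\<lambda>S xs. of_bool (wins \<pi> S xs)) k r (bump g ` S) (?ins g) =
      (if g < i + ?m then (if ?win then select_count k r (Suc i) ?m else 0) else 0)"
    if "g \<le> k + i" for g
  proof -
    have IH: "completions (\<lambda>S xs. of_bool (wins \<pi> S xs)) k r (bump g ` S) (?ins g) =
      (if ?ins g ! (j - 1) = Max (set (?ins g))
       then select_count k r (Suc i) (best_signal (bump g ` S) (?ins g)) else 0)"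
      using Suc.IH[OF insert_in_configs[OF c that] stops_at_insert[OF Suc.prems(2)]] .
    have nth: "?ins g ! (j - 1) = bump g (ys ! (j - 1))"
      using j by (simp add: nth_append)
    show ?thesis
    proof (cases "g < i + ?m")
      case True
      then show ?thesis
        unfolding IH nth insert_below(2,4)[OF c that True] by simp
    next
      case False
      have "bump g (ys ! (j - 1)) < real g"
        using insert_above(2)[OF c that False] j by simp
      then show ?thesis
        unfolding IH nth insert_above(1)[OF c that False] using False by simp
    qed
  qed
  then have "completions (\<lambda>S xs. of_bool (wins \<pi> S xs)) k (Suc r) S ys =
      (\<Sum>g\<le>k + i. if g < i + ?m then (if ?win then select_count k r (Suc i) ?m else 0) else 0)"
    by (simp add: len)
  also have "\<dots> = (if ?win then select_count k (Suc r) i ?m else 0)"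
    using sum_insertions[OF best_signal_le[OF c], where i = i and f = "\<lambda>_. 0"] by simp
  finally show ?case .
qed

text \<open>Value of selecting the newcomer: it has already lost if it is below the current best,
  and otherwise it is the new best one with signal \<open>g - i\<close>.\<close>

lemma completions_insert:
  assumes c: "(S, ys) \<in> configs k (initial (k + i))" and g: "g \<le> k + i"
    and stop: "\<pi> (bump g ` S) (map (bump g) ys @ [real g])"
    and before: "\<forall>j\<in>{1..i}. \<not> \<pi> S (take j ys)"
  shows "completions (\<lambda>S xs. of_bool (wins \<pi> S xs)) k r (bump g ` S) (map (bump g) ys @ [real g]) =
    (if g < i + best_signal S ys then 0 else select_count k r (Suc i) (g - i))"
proof -
  let ?ys = "map (bump g) ys @ [real g]"
  have len: "length ys = i"
    using c by (rule configs_initialD)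
  have "stops_at \<pi> (bump g ` S) ?ys (Suc i)"
    using stop before policy_take_insert[of _ ys g S "real g"] len
    by (auto simp: stops_at_def less_Suc_eq_le simp del: take_append)
  note * = completions_stopped[OF insert_in_configs[OF c g] this, of r]
  have nth: "?ys ! (Suc i - 1) = real g"
    using len by (simp add: nth_append)
  show ?thesis
  proof (cases "g < i + best_signal S ys")
    case True
    \<comment> \<open>\<open>bump g\<close> omits the value \<open>g\<close>, so the newcomer
      differs from the maximum.\<close>
    have "real g \<noteq> bump g (Max (set ys))"
      by (simp add: bump_def)
    then show ?thesis
      unfolding * nth insert_below(2)[OF c g True] using True by simp
  next
    case False
    then show ?thesis
      unfolding * nth insert_above(1,4)[OF c g False] by simp
  qed
qed

lemma not_stopped_insert:
  assumes "\<not> \<pi> (bump g ` S) (map (bump g) ys @ [x])" "\<forall>j\<in>{1..length ys}. \<not> \<pi> S (take j ys)"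
  shows "\<forall>j\<in>{1..Suc (length ys)}. \<not> \<pi> (bump g ` S) (take j (map (bump g) ys @ [x]))"
proof
  fix j assume j: "j \<in> {1..Suc (length ys)}"
  show "\<not> \<pi> (bump g ` S) (take j (map (bump g) ys @ [x]))"
  proof (cases "j = Suc (length ys)")
    case True
    then show ?thesis
      using assms(1) by simp
  next
    case False
    then have "j \<in> {1..length ys}"
      using j by simp
    then show ?thesis
      using policy_take_insert assms(2) by blast
  qed
qed

text \<open>Bellman inequality for policies that may use the whole relative order: at each
  insertion, selecting is valued by \<open>completions_insert\<close> and rejecting by the induction
  hypothesis, and both bounds depend only on the time and the best signal.\<close>

lemma completions_le_reject_count:
  assumes "(S, ys) \<in> configs k (initial (k + i))" "\<forall>j\<in>{1..i}. \<not> \<pi> S (take j ys)"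
  shows "completions (\<lambda>S xs. of_bool (wins \<pi> S xs)) k r S ys \<le> reject_count k r i (best_signal S ys)"
  using assms
proof (induction r arbitrary: S ys i)
  case 0
  note c = configs_initialD[OF 0(1)]
  have "\<not> wins \<pi> S ys"
    using 0 c(1) by (auto simp: wins_def stops_at_def)
  then show ?case by simp
next
  case (Suc r)
  note c = Suc.prems(1)
  let ?m = "best_signal S ys"
  let ?ins = "\<lambda>g. map (bump g) ys @ [real g]"
  have len: "length ys = i"
    using c by (rule configs_initialD)
  have "completions (\<lambda>S xs. of_bool (wins \<pi> S xs)) k r (bump g ` S) (?ins g) \<le>
      (if g < i + ?m then reject_count k r (Suc i) ?m
       else max (select_count k r (Suc i) (g - i)) (reject_count k r (Suc i) (g - i)))"
    if "g \<le> k + i" for g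
  proof (cases "\<pi> (bump g ` S) (?ins g)")
    case True
    show ?thesis
      using completions_insert[OF c that True Suc.prems(2), of r] by auto
  next
    case False
    have "completions (\<lambda>S xs. of_bool (wins \<pi> S xs)) k r (bump g ` S) (?ins g) \<le>
        reject_count k r (Suc i) (best_signal (bump g ` S) (?ins g))"
      using not_stopped_insert[OF False] Suc.prems(2) len
      by (intro Suc.IH insert_in_configs[OF c that]) simp
    also have "\<dots> = (if g < i + ?m then reject_count k r (Suc i) ?m
        else reject_count k r (Suc i) (g - i))"
      using insert_below(4)[OF c that] insert_above(4)[OF c that] by simp
    also have "\<dots> \<le> (if g < i + ?m then reject_count k r (Suc i) ?m
       else max (select_count k r (Suc i) (g - i)) (reject_count k r (Suc i) (g - i)))"
      by simp
    finally show ?thesis .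
  qed
  then have "completions (\<lambda>S xs. of_bool (wins \<pi> S xs)) k (Suc r) S ys \<le>
      (\<Sum>g\<le>k + i. if g < i + ?m then reject_count k r (Suc i) ?m
       else max (select_count k r (Suc i) (g - i)) (reject_count k r (Suc i) (g - i)))"
    unfolding completions.simps len by (intro sum_mono) auto
  also have "\<dots> = reject_count k (Suc r) i ?m"
    using sum_insertions[OF best_signal_le[OF c]] by simp
  finally show ?case .
qed

end

section \<open>The optimal threshold policy\<close>

lemma best_so_far_map:
  assumes "ys \<noteq> []" "strict_mono_on (set ys) f"
  shows "best_so_far (map f ys) \<longleftrightarrow> best_so_far ys"
proof -
  have "f y < f (last ys) \<longleftrightarrow> y < last ys" if "y \<in> set (butlast ys)" for y
    using that assms by (intro strict_mono_on_less[OF assms(2)]) (auto dest: in_set_butlastD)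
  then show ?thesis
    using assms(1) by (simp add: best_so_far_def last_map map_butlast[symmetric])
qed

lemma order_based_threshold_policy: "order_based (threshold_policy t)"
  unfolding order_based_def
proof (intro allI impI)
  fix S ys and f :: "real \<Rightarrow> real"
  assume ne: "ys \<noteq> []" and mono: "strict_mono_on (S \<union> set ys) f"
  have "strict_mono_on (set ys) f" "strict_mono_on (insert (last ys) S) f"
    using mono by (rule monotone_on_subset; use ne in auto)+
  then show "threshold_policy t (f ` S) (map f ys) = threshold_policy t S ys"
    using ne by (simp add: threshold_policy_def best_so_far_map last_map signal_image)
qed

text \<open>First time at which selecting a best-so-far secretary of signal \<open>s\<close> is at
  least as good as rejecting it and continuing optimally; ties favour selection. The argument
  \<open>n - i\<close> is the number of secretaries still to come.\<close>

definition optimal_threshold :: "nat \<Rightarrow> nat \<Rightarrow> nat \<Rightarrow> nat" where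
  "optimal_threshold n k s =
     (LEAST i. 1 \<le> i \<and> reject_count k (n - i) i s \<le> select_count k (n - i) i s)"

text \<open>Time \<open>n\<close> qualifies, since rejecting the last secretary has value 0.\<close>

lemma optimal_threshold_props:
  assumes "n \<ge> 1"
  shows "optimal_threshold n k s \<in> {1..n}"
    and "reject_count k (n - optimal_threshold n k s) (optimal_threshold n k s) s
      \<le> select_count k (n - optimal_threshold n k s) (optimal_threshold n k s) s"
proof -
  let ?P = "\<lambda>i. 1 \<le> i \<and> reject_count k (n - i) i s \<le> select_count k (n - i) i s"
  have n: "?P n"
    using assms by simp
  show "optimal_threshold n k s \<in> {1..n}"
    "reject_count k (n - optimal_threshold n k s) (optimal_threshold n k s) s
      \<le> select_count k (n - optimal_threshold n k s) (optimal_threshold n k s) s"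
    using LeastI[of ?P, OF n] Least_le[of ?P, OF n] by (auto simp: optimal_threshold_def)
qed

text \<open>This is why a single threshold per signal suffices: a favourable comparison propagates
  to all later times. The converse is minimality of the threshold.\<close>

lemma optimal_threshold_le_iff:
  assumes "1 \<le> i" "i \<le> n"
  shows "optimal_threshold n k s \<le> i \<longleftrightarrow> reject_count k (n - i) i s \<le> select_count k (n - i) i s"
proof
  assume "optimal_threshold n k s \<le> i"
  then show "reject_count k (n - i) i s \<le> select_count k (n - i) i s"
    using assms
  proof (induction i rule: dec_induct)
    case base
    then show ?case
      by (intro optimal_threshold_props) simp
  next
    case (step j)
    have j: "1 \<le> j"
      using optimal_threshold_props(1)[of n k s] step by simp
    have "n - j = Suc (n - Suc j)"
      using step by simp
    moreover have "reject_count k (n - j) j s \<le> select_count k (n - j) j s"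
      using step.IH step.prems j by simp
    ultimately have "(j + s) * reject_count k (n - Suc j) (Suc j) s +
        (\<Sum>s=s..k. max (select_count k (n - Suc j) (Suc j) s) (reject_count k (n - Suc j) (Suc j) s))
        \<le> (j + s) * select_count k (n - Suc j) (Suc j) s"
      by (simp only: reject_count.simps select_count.simps)
    \<comment> \<open>Dropping the nonnegative sum keeps the inequality; the factor
      \<open>j + s\<close> cancels because \<open>1 \<le> j\<close>.\<close>
    then have "(j + s) * reject_count k (n - Suc j) (Suc j) s \<le>
        (j + s) * select_count k (n - Suc j) (Suc j) s"
      by (rule add_leD1)
    then show ?case
      using j by simp
  qed
next
  assume "reject_count k (n - i) i s \<le> select_count k (n - i) i s"
  then show "optimal_threshold n k s \<le> i"
    unfolding optimal_threshold_def using assms by (intro Least_le) simp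
qed

text \<open>The induction of the upper bound, now with equality: by
  \<open>optimal_threshold_le_iff\<close> the policy takes the larger entry of each
  \<open>max\<close>. The condition \<open>i + r = n\<close> matches the time used by the thresholds
  with the number of secretaries left.\<close>

lemma completions_threshold_policy:
  fixes n k
  defines "\<pi> \<equiv> threshold_policy (optimal_threshold n k)"
  assumes "(S, ys) \<in> configs k (initial (k + i))" "\<forall>j\<in>{1..i}. \<not> \<pi> S (take j ys)" "i + r = n"
  shows "completions (\<lambda>S xs. of_bool (wins \<pi> S xs)) k r S ys = reject_count k r i (best_signal S ys)"
  using assms(2-4)
proof (induction r arbitrary: S ys i)
  case 0
  note c = configs_initialD[OF 0(1)]
  have "\<not> wins \<pi> S ys"
    using 0 c(1) by (auto simp: wins_def stops_at_def)
  then show ?case by simp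
next
  case (Suc r)
  note c = Suc.prems(1)
  have ob: "order_based \<pi>"
    unfolding \<pi>_def by (rule order_based_threshold_policy)
  let ?m = "best_signal S ys"
  let ?ins = "\<lambda>g. map (bump g) ys @ [real g]"
  have len: "length ys = i"
    using c by (rule configs_initialD)
  have r: "n - Suc i = r"
    using Suc.prems by simp
  have "completions (\<lambda>S xs. of_bool (wins \<pi> S xs)) k r (bump g ` S) (?ins g) =
      (if g < i + ?m then reject_count k r (Suc i) ?m
       else max (select_count k r (Suc i) (g - i)) (reject_count k r (Suc i) (g - i)))"
    if g: "g \<le> k + i" for g
  proof -
    have \<pi>: "\<pi> (bump g ` S) (?ins g) \<longleftrightarrow> \<not> g < i + ?m \<and>
        reject_count k r (Suc i) (g - i) \<le> select_count k r (Suc i) (g - i)"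
    proof (cases "g < i + ?m")
      case True
      then show ?thesis
        using insert_below(3)[OF c g] by (simp add: \<pi>_def threshold_policy_def)
    next
      case False
      then show ?thesis
        using insert_above(3,5)[OF c g] optimal_threshold_le_iff[of "Suc i" n k "g - i"] Suc.prems r
        by (simp add: \<pi>_def threshold_policy_def len)
    qed
    show ?thesis
    proof (cases "\<pi> (bump g ` S) (?ins g)")
      case True
      then show ?thesis
        using completions_insert[OF ob c g True Suc.prems(2), of r] \<pi> by simp
    next
      case False
      have "completions (\<lambda>S xs. of_bool (wins \<pi> S xs)) k r (bump g ` S) (?ins g) =
          reject_count k r (Suc i) (best_signal (bump g ` S) (?ins g))"
        using not_stopped_insert[OF ob False] Suc.prems(2,3) len
        by (intro Suc.IH insert_in_configs[OF c g]) simp_all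
      also have "\<dots> = (if g < i + ?m then reject_count k r (Suc i) ?m
          else reject_count k r (Suc i) (g - i))"
        using insert_below(4)[OF c g] insert_above(4)[OF c g] by simp
      finally show ?thesis
        using False \<pi> by auto
    qed
  qed
  then have "completions (\<lambda>S xs. of_bool (wins \<pi> S xs)) k (Suc r) S ys =
      (\<Sum>g\<le>k + i. if g < i + ?m then reject_count k r (Suc i) ?m
       else max (select_count k r (Suc i) (g - i)) (reject_count k r (Suc i) (g - i)))"
    by (simp add: len)
  also have "\<dots> = reject_count k (Suc r) i ?m"
    using sum_insertions[OF best_signal_le[OF c]] by simp
  finally show ?case .
qed

lemma win_prob_le_threshold_policy:
  assumes "order_based \<pi>" "finite X" "card X = n + k"
  shows "win_prob k X \<pi> \<le> win_prob k X (threshold_policy (optimal_threshold n k))"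
proof -
  have c: "(initial k, []) \<in> configs k (initial (k + 0))"
    by (simp add: configs_initial_self)
  show ?thesis
    using completions_le_reject_count[OF assms(1) c, of n] completions_threshold_policy[OF c, of n n]
    by (simp add: win_prob_eq_completions[OF assms]
        win_prob_eq_completions[OF order_based_threshold_policy assms(2,3)] divide_right_mono)
qed

theorem theorem2:
  fixes n k :: nat
  assumes "n \<ge> 1"
  shows "\<exists>t. t \<in> {0..k} \<rightarrow> {1..n} \<and> optimal_policy n k (threshold_policy t)"
proof (intro exI conjI)
  let ?t = "optimal_threshold n k"
  show "?t \<in> {0..k} \<rightarrow> {1..n}"
    using optimal_threshold_props(1)[OF assms] by blast
  show "optimal_policy n k (threshold_policy ?t)"
    unfolding optimal_policy_def
  proof (intro conjI allI impI order_based_threshold_policy)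
    fix X :: "real set" and M :: "policy measure"
    assume X: "finite X" "card X = n + k" and M: "randomized_policy M"
    interpret prob_space M
      using M by (simp add: randomized_policy_def)
    show "randomized_win_prob k X M \<le> win_prob k X (threshold_policy ?t)"
    proof (cases "integrable M (win_prob k X)")
      case True
      then show ?thesis
        unfolding randomized_win_prob_def
      proof (rule integral_le_const)
        \<comment> \<open>A randomized policy averages over deterministic order-based ones, each of
          which obeys the bound.\<close>
        show "AE \<pi> in M. win_prob k X \<pi> \<le> win_prob k X (threshold_policy ?t)"
          using M X by (intro AE_I2 win_prob_le_threshold_policy) (auto simp: randomized_policy_def)
      qed
    next
      case False
      \<comment> \<open>The integral of a non-integrable function is 0 by convention, hence at most
        any probability.\<close>
      then have "randomized_win_prob k X M = 0"
        by (simp add: randomized_win_prob_def not_integrable_integral_eq)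
      then show ?thesis
        by (simp add: win_prob_def)
    qed
  qed
qed

end
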